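(* Let $p>0$ and $A>1$. There exists a constant $C=C(p,A)>0$ such that for every lacunary sequence $\{\lambda_k\}_{k\ge1}$ of positive integers with constant $A$ and every holomorphic function $f$ on the unit disc $\mathbb{B}^1$ of the form $f(z)=\sum_{k=1}^\infty a_{\lambda_k}z^{\lambda_k}$, $$C^{-1}\int_0^1\Big(\sum_{k=1}^\infty|a_{\lambda_k}|^2r^{2\lambda_k}\Big)^{p/2}dr\le\int_{\mathbb{B}^1}|f|^p\le C\int_0^1\Big(\sum_{k=1}^\infty|a_{\lambda_k}|^2r^{2\lambda_k}\Big)^{p/2}dr,$$ where the integrals take values in $[0,\infty]$. In particular, a holomorphic function $f(z)=\sum_{k=1}^\infty a_{\lambda_k}z^{\lambda_k}$ on $\mathbb{B}^1$, with $\{\lambda_k\}$ lacunary with constant $A$, is $L^p$-integrable on $\mathbb{B}^1$ if and only if $\int_0^1\big(\sum_{k=1}^\infty|a_{\lambda_k}|^2r^{2\lambda_k}\big)^{p/2}dr$ is finite.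
   Context: $\mathbb{B}^1=\{z\in\mathbb{C}:|z|<1\}$, and integrals over $\mathbb{B}^1$ are with respect to Lebesgue measure. A sequence $\{\lambda_k\}_{k\ge1}$ is called lacunary with constant $A$, where $A>1$, if $\lambda_{k+1}\ge A\lambda_k$ for all $k\ge 1$. *)

theory Defs
  imports "HOL-Analysis.Analysis"
begin

(* Sequences indexed by k >= 1 in the mathematics are indexed by k >= 0 here. *)
definition lacunary :: "real \<Rightarrow> (nat \<Rightarrow> real) \<Rightarrow> bool" where
  "lacunary A lam \<longleftrightarrow> A > 1 \<and> (\<forall>k. lam (Suc k) \<ge> A * lam k)"

(* a is indexed by exponents, so the k-th coefficient is a (lam k); values outside range lam
   are never used. *)
definition holomorphic_gap_series ::
  "(nat \<Rightarrow> nat) \<Rightarrow> (nat \<Rightarrow> complex) \<Rightarrow> (complex \<Rightarrow> complex) \<Rightarrow> bool" where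
  "holomorphic_gap_series lam a f \<longleftrightarrow>
     f holomorphic_on ball 0 1 \<and>
     (\<forall>z\<in>ball 0 1. (\<lambda>k. a (lam k) * z ^ lam k) sums f z)"

definition Lp_integrable_on :: "real \<Rightarrow> complex set \<Rightarrow> (complex \<Rightarrow> complex) \<Rightarrow> bool" where
  "Lp_integrable_on p S f \<longleftrightarrow>
     set_borel_measurable lebesgue S f \<and> set_integrable lebesgue S (\<lambda>z. norm (f z) powr p)"

definition disc_integral :: "real \<Rightarrow> (complex \<Rightarrow> complex) \<Rightarrow> ennreal" where
  "disc_integral p f = (\<integral>\<^sup>+z\<in>ball 0 1. ennreal (norm (f z) powr p) \<partial>lebesgue)"

(* The endpoint r = 1, where the inner series may diverge (and a real-valued suminf would be
   meaningless), is left out; it is a null set.  For r < 1 the inner series converges whenever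
   the gap series with these coefficients converges on the unit disc. *)
definition square_function_integral ::
  "real \<Rightarrow> (nat \<Rightarrow> nat) \<Rightarrow> (nat \<Rightarrow> complex) \<Rightarrow> ennreal" where
  "square_function_integral p lam a =
     (\<integral>\<^sup>+r\<in>{0..<1}. ennreal ((\<Sum>k. (norm (a (lam k)))\<^sup>2 * r ^ (2 * lam k)) powr (p / 2)) \<partial>lebesgue)"

end

theory Submission
  imports Defs
begin

text \<open>
  On a fixed circle, a lacunary series with \<open>\<Sum>|c\<^sub>k|\<^sup>2 = 1\<close> splits into finitely many series whose
  frequencies at least double; for those \<open>exp (Re g)\<close> is dominated by a Riesz product whose integral
  is \<open>2\<pi> \<Prod> cosh |c\<^sub>k|\<close>, so \<open>g\<close> has uniformly bounded exponential moments and hence all \<open>L\<^sup>p\<close> norms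
  on the circle are bounded above. Together with the \<open>L\<^sup>2\<close> identity and the fourth moment this also bounds
  them below, so \<open>\<integral>|g|\<^sup>p\<close> is comparable to \<open>(\<Sum>|c\<^sub>k|\<^sup>2) powr (p/2)\<close>.
  Instead of polar coordinates, the disc integral is averaged over all rotations; what remains is the
  integral of an increasing function of \<open>|z|\<close>, and \<open>|z|\<^sup>2\<close> is uniformly distributed
  on \<open>[0,1)\<close>.
\<close>

section \<open>Exponential moments of lacunary series on the circle\<close>

text \<open>Arc length on the unit circle in terms of the angle. It is not normalised, so the total
  mass \<open>2 * pi\<close> is carried along in the constants. Being a measure in its own right, it
  can enter Fubini's theorem directly.\<close>

definition circle_measure :: "real measure" where
  "circle_measure = restrict_space lborel {0..2 * pi}"

lemma space_circle_measure [simp]: "space circle_measure = {0..2 * pi}"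
  by (simp add: circle_measure_def space_restrict_space)

lemma measure_circle_measure: "measure circle_measure {0..2 * pi} = 2 * pi"
  by (simp add: circle_measure_def measure_restrict_space)

lemma finite_measure_circle_measure: "finite_measure circle_measure"
  by (rule finite_measureI) (simp add: circle_measure_def space_restrict_space emeasure_restrict_space)

lemma integrable_circle_measure:
  fixes g :: "real \<Rightarrow> 'b::{banach, second_countable_topology}"
  assumes "continuous_on UNIV g"
  shows "integrable circle_measure g"
proof -
  have "continuous_on {0..2*pi} g"
    using assms continuous_on_subset by blast
  then have "set_integrable lborel {0..2 * pi} g"
    unfolding set_integrable_def by (intro borel_integrable_compact) auto
  then show ?thesis
    unfolding circle_measure_def by (subst integrable_restrict_space) (auto simp: set_integrable_def)
qed

lemma integral_circle_measure_cis:
  fixes m :: int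
  assumes "m \<noteq> 0"
  shows "(LINT t|circle_measure. cis (of_int m * t)) = 0"
proof -
  have "(LINT t|circle_measure. cis (of_int m * t))
      = (LINT t|lborel. indicator {0..2*pi} t *\<^sub>R cis (of_int m * t))"
    unfolding circle_measure_def by (subst integral_restrict_space) auto
  also have "\<dots> = cis (of_int m * (2 * pi)) / (\<i> * of_int m) - cis (of_int m * 0) / (\<i> * of_int m)"
  proof (rule integral_FTC_Icc)
    fix x :: real
    have "((\<lambda>t. exp (\<i> * (of_int m * of_real t)) / (\<i> * of_int m)) has_vector_derivative
        exp (\<i> * (of_int m * of_real x))) (at x within {0..2*pi})"
      using assms by (auto intro!: derivative_eq_intros has_vector_derivative_real_field simp: mult.left_commute[of \<i>])
    then show "((\<lambda>t. cis (of_int m * t) / (\<i> * of_int m)) has_vector_derivative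
        cis (of_int m * x)) (at x within {0..2*pi})"
      by (simp add: cis_conv_exp)
  qed (auto intro!: continuous_intros)
  also have "cis (of_int m * (2 * pi)) = 1"
    by (metis cis_multiple_2pi Ints_of_int mult.commute)
  finally show ?thesis by simp
qed

section \<open>Riesz products and their integrals\<close>

lemma Re_conv_cnj: "complex_of_real (Re z) = (z + cnj z) / 2"
  by (simp add: complex_add_cnj)

text \<open>Induction on the largest index. The second conjunct confines the spectrum of the product
  to \<open>[-S, S]\<close>, where \<open>S\<close> is the sum of its frequencies. The next
  frequency exceeds \<open>S\<close>, so shifting by it either way moves the spectrum off zero, and
  only the constant term of the new factor contributes to the mean.\<close>

lemma integral_riesz_product_aux:
  fixes n :: "nat \<Rightarrow> nat" and \<alpha> :: "nat \<Rightarrow> real" and \<beta> :: "nat \<Rightarrow> complex"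
  assumes "finite K" "\<And>k. k \<in> K \<Longrightarrow> (\<Sum>i\<in>{i\<in>K. i < k}. n i) < n k"
  defines "P \<equiv> \<lambda>K t. \<Prod>k\<in>K. complex_of_real (\<alpha> k + Re (\<beta> k * cis (real (n k) * t)))"
  shows "(LINT t|circle_measure. P K t) = of_real (2 * pi * (\<Prod>k\<in>K. \<alpha> k)) \<and>
    (\<forall>m::int. \<bar>m\<bar> > int (\<Sum>k\<in>K. n k) \<longrightarrow> (LINT t|circle_measure. P K t * cis (of_int m * t)) = 0)"
  using assms(1,2)
proof (induction rule: finite_linorder_max_induct)
  case empty
  then show ?case
    by (auto simp: P_def measure_circle_measure integral_circle_measure_cis scaleR_conv_of_real)
next
  case (insert b K)
  have bK: "b \<notin> K" using insert.hyps by auto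
  have sub: "{i \<in> insert b K. i < k} = {i \<in> K. i < k}" if "k \<in> K" for k
    using that insert.hyps by auto
  have subb: "{i \<in> insert b K. i < b} = K"
    using insert.hyps by auto
  have nb: "(\<Sum>i\<in>K. n i) < n b"
    using insert.prems[of b] subb by simp
  have "(\<Sum>i\<in>{i \<in> K. i < k}. n i) < n k" if "k \<in> K" for k
    using insert.prems[of k] sub[OF that] that by simp
  note IH = insert.IH[OF this]
  have cont: "continuous_on UNIV (P K)"
    unfolding P_def by (intro continuous_intros)
  have int: "integrable circle_measure (\<lambda>t. P K t * cis (of_int m * t))" for m :: int
    by (intro integrable_circle_measure continuous_intros cont)
  \<comment> \<open>The new factor contributes the frequencies \<open>0\<close>, \<open>n b\<close>
    and \<open>- n b\<close>, because a real part is half a character plus half its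
    conjugate.\<close>
  have expand: "P (insert b K) t * cis (of_int m * t) =
      of_real (\<alpha> b) * (P K t * cis (of_int m * t)) +
      \<beta> b / 2 * (P K t * cis (of_int (m + int (n b)) * t)) +
      cnj (\<beta> b) / 2 * (P K t * cis (of_int (m - int (n b)) * t))" for t and m :: int
  proof -
    have e: "P (insert b K) t = complex_of_real (\<alpha> b + Re (\<beta> b * cis (real (n b) * t))) * P K t"
      using insert.hyps bK by (simp add: P_def)
    have "cis (of_int (m + int (n b)) * t) = cis (real (n b) * t) * cis (of_int m * t)"
      by (simp add: cis_mult algebra_simps)
    moreover have "cis (of_int (m - int (n b)) * t) = cnj (cis (real (n b) * t)) * cis (of_int m * t)"
      by (simp add: cis_mult cis_cnj algebra_simps)
    ultimately show ?thesis
      unfolding e of_real_add Re_conv_cnj complex_cnj_mult by (simp add: field_simps)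
  qed
  have I: "(LINT t|circle_measure. P (insert b K) t * cis (of_int m * t)) =
      of_real (\<alpha> b) * (LINT t|circle_measure. P K t * cis (of_int m * t)) +
      \<beta> b / 2 * (LINT t|circle_measure. P K t * cis (of_int (m + int (n b)) * t)) +
      cnj (\<beta> b) / 2 * (LINT t|circle_measure. P K t * cis (of_int (m - int (n b)) * t))" for m :: int
    unfolding expand
    by (subst Bochner_Integration.integral_add Bochner_Integration.integral_add
          | intro Bochner_Integration.integrable_add integrable_mult_right int | simp only: integral_mult_right_zero)+
  have "(LINT t|circle_measure. P (insert b K) t) = of_real (\<alpha> b) * (LINT t|circle_measure. P K t)"
  proof -
    \<comment> \<open>By \<open>nb\<close>, the frequencies \<open>n b\<close> and
      \<open>- n b\<close> lie outside the spectrum of \<open>P K\<close>.\<close>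
    have z: "(LINT t|circle_measure. P K t * cis (of_int m * t)) = 0" if "\<bar>m\<bar> = int (n b)" for m :: int
      using IH nb that by (metis of_nat_less_iff)
    show ?thesis
      using I[of 0] z[of "0 + int (n b)"] z[of "0 - int (n b)"] by simp
  qed
  then have 1: "(LINT t|circle_measure. P (insert b K) t) = of_real (2 * pi * (\<Prod>k\<in>insert b K. \<alpha> k))"
    using IH bK insert.hyps by simp
  have 2: "(LINT t|circle_measure. P (insert b K) t * cis (of_int m * t)) = 0"
    if "\<bar>m\<bar> > int (\<Sum>k\<in>insert b K. n k)" for m :: int
  proof -
    have "\<bar>m\<bar> > int (\<Sum>k\<in>K. n k)" "\<bar>m + int (n b)\<bar> > int (\<Sum>k\<in>K. n k)" "\<bar>m - int (n b)\<bar> > int (\<Sum>k\<in>K. n k)"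
      using that bK insert.hyps by auto
    then show ?thesis
      using I[of m] IH by (simp del: of_int_add of_int_minus of_int_diff of_int_of_nat_eq of_nat_sum)
  qed
  show ?case using 1 2 by blast
qed

lemma integral_riesz_product:
  fixes n :: "nat \<Rightarrow> nat" and \<alpha> :: "nat \<Rightarrow> real" and \<beta> :: "nat \<Rightarrow> complex"
  assumes "finite K" "\<And>k. k \<in> K \<Longrightarrow> (\<Sum>i\<in>{i\<in>K. i < k}. n i) < n k"
  shows "(LINT t|circle_measure. (\<Prod>k\<in>K. \<alpha> k + Re (\<beta> k * cis (real (n k) * t)))) = 2 * pi * (\<Prod>k\<in>K. \<alpha> k)"
  using integral_riesz_product_aux[OF assms, of \<alpha> \<beta>]
  unfolding of_real_prod[symmetric] integral_complex_of_real of_real_eq_iff by blast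

text \<open>By convexity, \<open>exp\<close> lies below its chord over the interval between
  \<open>- x\<close> and \<open>x\<close>. The bound is affine in \<open>t\<close>, which is what
  turns the exponential of a sum into a Riesz product.\<close>

lemma exp_mult_le_cosh_sinh:
  fixes x t :: real
  assumes "\<bar>t\<bar> \<le> 1"
  shows "exp (x * t) \<le> cosh x + t * sinh x"
proof -
  have "exp ((1 - (1 + t) / 2) *\<^sub>R (- x) + ((1 + t) / 2) *\<^sub>R x) \<le> (1 - (1 + t) / 2) * exp (- x) + ((1 + t) / 2) * exp x"
    by (rule convex_onD[OF exp_convex]) (use assms in auto)
  moreover have "(1 - (1 + t) / 2) *\<^sub>R (- x) + ((1 + t) / 2) *\<^sub>R x = x * t"
    by (simp add: field_simps)
  moreover have "(1 - (1 + t) / 2) * exp (- x) + ((1 + t) / 2) * exp x = cosh x + t * sinh x"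
    by (simp add: cosh_def sinh_def field_simps)
  ultimately show ?thesis by simp
qed

text \<open>Evenness reduces this to \<open>x \<ge> 0\<close>. Up to 1, quadratic bounds for
  \<open>exp x\<close> and \<open>exp (- x)\<close> average to \<open>1 + x\<^sup>2\<close>; beyond
  1, \<open>x \<le> x\<^sup>2\<close> suffices.\<close>

lemma cosh_le_exp_square:
  fixes x :: real
  shows "cosh x \<le> exp (x\<^sup>2)"
proof -
  have pos: "cosh x \<le> exp (x\<^sup>2)" if x: "x \<ge> 0" for x :: real
  proof (cases "x \<le> 1")
    case True
    have le: "exp x \<le> 1 + x + x\<^sup>2" using exp_bound[of x] x True by simp
    have "1 + x\<^sup>2 / 2 + x \<le> exp x"
      using exp_lower_Taylor_quadratic[OF x] by simp
    then have "exp (- x) \<le> 1 / (1 + x + x\<^sup>2 / 2)"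
      unfolding exp_minus inverse_eq_divide using x by (intro divide_left_mono) (auto intro!: mult_pos_pos add_pos_nonneg)
    also have "\<dots> \<le> 1 - x + x\<^sup>2"
    proof -
      have "1 \<le> (1 - x + x\<^sup>2) * (1 + x + x\<^sup>2 / 2)"
      proof -
        have "(1 - x + x\<^sup>2) * (1 + x + x\<^sup>2 / 2) = 1 + (x^2 + x^3 + x^4) / 2"
          by (simp add: field_simps power2_eq_square power3_eq_cube power4_eq_xxxx)
        then show ?thesis using x by simp
      qed
      moreover have "0 < 1 + x + x\<^sup>2 / 2"
        using x by (intro add_pos_nonneg) auto
      ultimately show ?thesis by (simp add: divide_le_eq)
    qed
    finally have "cosh x \<le> 1 + x\<^sup>2" using le by (simp add: cosh_def)
    also have "\<dots> \<le> exp (x\<^sup>2)" by simp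
    finally show ?thesis .
  next
    case False
    have "cosh x \<le> exp x" using x by (simp add: cosh_def)
    also have "\<dots> \<le> exp (x\<^sup>2)" using False by (simp add: power2_eq_square)
    finally show ?thesis .
  qed
  show ?thesis
    using pos[of x] pos[of "- x"] by (cases "x \<ge> 0") auto
qed

text \<open>Each exponential factor is replaced by its chord bound. The result is a Riesz product
  whose integral is known exactly, and \<open>cosh_le_exp_square\<close> turns the product of the
  \<open>cosh\<close> terms into a sum of squares in the exponent.\<close>

lemma integral_exp_Re_dissociate_le:
  fixes n :: "nat \<Rightarrow> nat" and c :: "nat \<Rightarrow> complex"
  assumes "finite K" "\<And>k. k \<in> K \<Longrightarrow> (\<Sum>i\<in>{i\<in>K. i < k}. n i) < n k"
  shows "(LINT t|circle_measure. exp (\<Sum>k\<in>K. Re (c k * cis (real (n k) * t))))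
    \<le> 2 * pi * exp (\<Sum>k\<in>K. (norm (c k))\<^sup>2)"
proof -
  \<comment> \<open>\<open>sgn (c k)\<close> carries the phase of the coefficient, so that the real
    part formed with \<open>\<beta> k\<close> is exactly the linear term
    \<open>s * sinh (norm (c k))\<close> of the chord.\<close>
  define \<beta> where "\<beta> k = of_real (sinh (norm (c k))) * sgn (c k)" for k
  have "(LINT t|circle_measure. exp (\<Sum>k\<in>K. Re (c k * cis (real (n k) * t))))
     \<le> (LINT t|circle_measure. (\<Prod>k\<in>K. cosh (norm (c k)) + Re (\<beta> k * cis (real (n k) * t))))"
  proof (rule integral_mono)
    fix t
    have "exp (\<Sum>k\<in>K. Re (c k * cis (real (n k) * t))) = (\<Prod>k\<in>K. exp (Re (c k * cis (real (n k) * t))))"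
      by (rule exp_sum) fact
    also have "\<dots> \<le> (\<Prod>k\<in>K. cosh (norm (c k)) + Re (\<beta> k * cis (real (n k) * t)))"
    proof (rule prod_mono, intro conjI)
      fix k
      define s where "s = Re (sgn (c k) * cis (real (n k) * t))"
      have "\<bar>s\<bar> \<le> 1"
        unfolding s_def by (rule order_trans[OF abs_Re_le_cmod]) (simp add: norm_mult norm_sgn)
      moreover have "Re (c k * cis (real (n k) * t)) = norm (c k) * s"
      proof -
        have "c k = of_real (norm (c k)) * sgn (c k)"
          by (simp add: sgn_eq)
        then have "c k * cis (real (n k) * t) = of_real (norm (c k)) * (sgn (c k) * cis (real (n k) * t))"
          by (metis mult.assoc)
        then show ?thesis by (simp only: s_def Re_complex_of_real Im_complex_of_real times_complex.sel)
      qed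
      moreover have "Re (\<beta> k * cis (real (n k) * t)) = s * sinh (norm (c k))"
        by (simp add: \<beta>_def s_def algebra_simps)
      ultimately show "exp (Re (c k * cis (real (n k) * t))) \<le> cosh (norm (c k)) + Re (\<beta> k * cis (real (n k) * t))"
        using exp_mult_le_cosh_sinh by presburger
    qed auto
    finally show "exp (\<Sum>k\<in>K. Re (c k * cis (real (n k) * t))) \<le> (\<Prod>k\<in>K. cosh (norm (c k)) + Re (\<beta> k * cis (real (n k) * t)))" .
  qed (intro integrable_circle_measure continuous_intros)+
  also have "\<dots> = 2 * pi * (\<Prod>k\<in>K. cosh (norm (c k)))"
    using assms by (rule integral_riesz_product)
  also have "\<dots> \<le> 2 * pi * exp (\<Sum>k\<in>K. (norm (c k))\<^sup>2)"
    unfolding exp_sum[OF assms(1)]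
    by (intro mult_left_mono prod_mono) (auto intro: cosh_le_exp_square)
  finally show ?thesis .
qed

section \<open>Splitting lacunary sequences into doubling ones\<close>

lemma sum_doubling_less:
  fixes n :: "nat \<Rightarrow> nat"
  assumes "finite K" "\<And>i j. i \<in> K \<Longrightarrow> j \<in> K \<Longrightarrow> i < j \<Longrightarrow> 2 * n i \<le> n j"
    and "\<And>i. i \<in> K \<Longrightarrow> 2 * n i \<le> L" "L > 0"
  shows "(\<Sum>i\<in>K. n i) < L"
  using assms
proof (induction arbitrary: L rule: finite_linorder_max_induct)
  case (insert b K)
  have bK: "b \<notin> K" using insert.hyps by auto
  show ?case
  \<comment> \<open>Taken with the bound \<open>n b\<close>, the induction hypothesis keeps the
    earlier frequencies below \<open>n b\<close> in sum, so the total is below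
    \<open>2 * n b \<le> L\<close>. This needs \<open>n b > 0\<close>; if \<open>n b = 0\<close>,
    doubling forces the earlier frequencies to vanish too.\<close>
  proof (cases "n b = 0")
    case True
    then have "\<forall>i\<in>K. n i = 0" using insert.hyps insert.prems(1) by fastforce
    then show ?thesis using insert.hyps insert.prems True bK by simp
  next
    case False
    have "(\<Sum>i\<in>K. n i) < n b"
      using insert.hyps insert.prems(1) False by (intro insert.IH) auto
    then show ?thesis using insert.hyps insert.prems(2)[of b] bK by simp
  qed
qed simp

lemma lacunary_growth:
  assumes "lacunary A lam"
  shows "A ^ d * lam i \<le> lam (i + d)"
proof (induction d)
  case (Suc d)
  have "A ^ Suc d * lam i = A * (A ^ d * lam i)" by simp
  also have "\<dots> \<le> A * lam (i + d)"
    using assms Suc by (intro mult_left_mono) (auto simp: lacunary_def)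
  also have "\<dots> \<le> lam (i + Suc d)" using assms by (simp add: lacunary_def)
  finally show ?case .
qed simp

text \<open>This makes each residue class of indices modulo \<open>M\<close> a doubling
  subsequence.\<close>

lemma lacunary_doubling:
  fixes lam :: "nat \<Rightarrow> nat"
  assumes "lacunary A (\<lambda>k. real (lam k))" "2 \<le> A ^ M" "i + M \<le> j"
  shows "2 * lam i \<le> lam j"
proof -
  obtain d where d: "j = i + d" "M \<le> d" using assms(3) by (metis add_le_cancel_left le_Suc_ex add.assoc le_add1)
  have "2 \<le> A ^ d"
    using assms d by (meson lacunary_def less_imp_le order_trans power_increasing)
  then have "2 * real (lam i) \<le> A ^ d * real (lam i)" by (intro mult_right_mono) auto
  also have "\<dots> \<le> real (lam j)" using lacunary_growth[OF assms(1)] d by blast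
  finally show ?thesis by linarith
qed

lemma lacunary_strict_mono:
  fixes lam :: "nat \<Rightarrow> nat"
  assumes "\<And>k. lam k > 0" "lacunary A (\<lambda>k. real (lam k))"
  shows "strict_mono lam"
  unfolding strict_mono_Suc_iff
proof
  fix k
  have "real (lam k) < A * real (lam k)" using assms by (auto simp: lacunary_def)
  also have "\<dots> \<le> real (lam (Suc k))" using assms by (auto simp: lacunary_def)
  finally show "lam k < lam (Suc k)" by simp
qed

lemma exp_average_le:
  fixes x :: "nat \<Rightarrow> real"
  assumes "M > 0"
  shows "exp ((\<Sum>j<M. x j) / real M) \<le> (\<Sum>j<M. exp (x j)) / real M"
proof -
  have "exp (\<Sum>j<M. (1 / real M) *\<^sub>R x j) \<le> (\<Sum>j<M. (1 / real M) * exp (x j))"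
    by (rule convex_on_sum[OF _ _ exp_convex]) (use assms in auto)
  then show ?thesis by (simp add: sum_divide_distrib)
qed

text \<open>The indices are split by residue modulo \<open>M\<close>. Within a class the frequencies
  double, hence each exceeds the sum of the earlier ones. Jensen's inequality recombines the
  classes, at the price of the factor \<open>1 / real M\<close> in the exponent.\<close>

lemma integral_exp_Re_lacunary_le:
  fixes lam :: "nat \<Rightarrow> nat" and c :: "nat \<Rightarrow> complex"
  assumes lam: "\<And>k. lam k > 0" "lacunary A (\<lambda>k. real (lam k))" and M: "M > 0" "2 \<le> A ^ M"
  shows "(LINT t|circle_measure. exp (Re (\<Sum>k<N. c k * cis (real (lam k) * t)) / real M))
    \<le> 2 * pi * exp (\<Sum>k<N. (norm (c k))\<^sup>2)"
proof -
  define K where "K j = {k\<in>{..<N}. k mod M = j}" for j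
  define x where "x j t = (\<Sum>k\<in>K j. Re (c k * cis (real (lam k) * t)))" for j t
  have split: "Re (\<Sum>k<N. c k * cis (real (lam k) * t)) = (\<Sum>j<M. x j t)" for t
    unfolding x_def K_def Re_sum by (rule sum.group[symmetric]) (use M in auto)
  have cont: "continuous_on UNIV (x j)" for j
    unfolding x_def by (intro continuous_intros)
  have bound: "(LINT t|circle_measure. exp (x j t)) \<le> 2 * pi * exp (\<Sum>k<N. (norm (c k))\<^sup>2)" for j
  proof -
    have "(LINT t|circle_measure. exp (x j t)) \<le> 2 * pi * exp (\<Sum>k\<in>K j. (norm (c k))\<^sup>2)"
      unfolding x_def
    proof (rule integral_exp_Re_dissociate_le)
      fix k assume k: "k \<in> K j"
      have dbl: "2 * lam i \<le> lam i'" if "i \<in> K j" "i' \<in> K j" "i < i'" for i i'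
      proof (rule lacunary_doubling[OF lam(2) M(2)])
        \<comment> \<open>Distinct indices in one class differ by a positive multiple of
          \<open>M\<close>, hence by at least \<open>M\<close>.\<close>
        have "M dvd i' - i" using that by (metis (mono_tags, lifting) K_def less_imp_le mem_Collect_eq mod_eq_dvd_iff_nat)
        then have "M \<le> i' - i" using that by (intro dvd_imp_le) auto
        then show "i + M \<le> i'" using that by simp
      qed
      show "(\<Sum>i\<in>{i \<in> K j. i < k}. lam i) < lam k"
        by (rule sum_doubling_less) (use k lam dbl in \<open>auto simp: K_def\<close>)
    qed (simp add: K_def)
    also have "\<dots> \<le> 2 * pi * exp (\<Sum>k<N. (norm (c k))\<^sup>2)"
      by (auto intro!: sum_mono2 simp: K_def)
    finally show ?thesis .
  qed
  have "(LINT t|circle_measure. exp (Re (\<Sum>k<N. c k * cis (real (lam k) * t)) / real M))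
      \<le> (LINT t|circle_measure. (\<Sum>j<M. exp (x j t)) / real M)"
    unfolding split
    by (intro integral_mono integrable_circle_measure continuous_intros cont exp_average_le M) (use M in auto)
  also have "\<dots> = (\<Sum>j<M. (LINT t|circle_measure. exp (x j t))) / real M"
    by (simp, subst Bochner_Integration.integral_sum)
       (auto intro!: integrable_circle_measure continuous_intros cont)
  also have "\<dots> \<le> (\<Sum>j<M. 2 * pi * exp (\<Sum>k<N. (norm (c k))\<^sup>2)) / real M"
    by (intro divide_right_mono sum_mono bound) auto
  also have "\<dots> = 2 * pi * exp (\<Sum>k<N. (norm (c k))\<^sup>2)" using M by simp
  finally show ?thesis .
qed

text \<open>Since \<open>norm z \<le> |Re z| + |Im z|\<close>, one of the four directions
  \<open>1\<close>, \<open>-1\<close>, \<open>\<i>\<close>, \<open>- \<i>\<close> sees at least half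
  of \<open>norm z\<close>.\<close>

lemma exp_norm_le:
  fixes z :: complex and s :: real
  assumes "s \<ge> 0"
  shows "exp (s * norm z / 2) \<le> exp (s * Re z) + exp (s * Re (- z)) + exp (s * Re (\<i> * z)) + exp (s * Re (- \<i> * z))"
proof -
  have "norm z / 2 \<le> \<bar>Re z\<bar> \<or> norm z / 2 \<le> \<bar>Im z\<bar>" using cmod_le[of z] by linarith
  then consider "norm z / 2 \<le> Re z" | "norm z / 2 \<le> Re (- z)" | "norm z / 2 \<le> Re (\<i> * z)" | "norm z / 2 \<le> Re (- \<i> * z)"
    by fastforce
  then obtain w where "norm z / 2 \<le> w" "w \<in> {Re z, Re (- z), Re (\<i> * z), Re (- \<i> * z)}" by cases blast+
  moreover have "exp (s * norm z / 2) \<le> exp (s * w)" if "norm z / 2 \<le> w" for w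
    using mult_left_mono[OF that assms] by simp
  moreover have "exp a > 0" for a :: real by simp
  ultimately show ?thesis
    by (smt (verit, ccfv_threshold) empty_iff insert_iff)
qed

lemma integral_exp_norm_lacunary_le:
  fixes lam :: "nat \<Rightarrow> nat" and c :: "nat \<Rightarrow> complex"
  assumes lam: "\<And>k. lam k > 0" "lacunary A (\<lambda>k. real (lam k))" and M: "M > 0" "2 \<le> A ^ M"
  shows "(LINT t|circle_measure. exp (norm (\<Sum>k<N. c k * cis (real (lam k) * t)) / (2 * real M)))
    \<le> 8 * pi * exp (\<Sum>k<N. (norm (c k))\<^sup>2)"
proof -
  define E where "E u t = exp (Re (u * (\<Sum>k<N. c k * cis (real (lam k) * t))) / real M)" for u t
  have int: "integrable circle_measure (E u)" for u
    unfolding E_def by (intro integrable_circle_measure continuous_intros) (use M in auto)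
  \<comment> \<open>Multiplying every coefficient by the same unimodular \<open>u\<close> leaves the
    norms unchanged, so the bound for real parts covers all four directions.\<close>
  have bound: "(LINT t|circle_measure. E u t) \<le> 2 * pi * exp (\<Sum>k<N. (norm (c k))\<^sup>2)" if "norm u = 1" for u
    using integral_exp_Re_lacunary_le[OF lam M, where c = "\<lambda>k. u * c k" and N = N] that
    by (simp add: E_def sum_distrib_left mult.assoc norm_mult)
  have "(LINT t|circle_measure. exp (norm (\<Sum>k<N. c k * cis (real (lam k) * t)) / (2 * real M)))
     \<le> (LINT t|circle_measure. E 1 t + E (-1) t + E \<i> t + E (- \<i>) t)"
  proof (rule integral_mono)
    fix t
    show "exp (norm (\<Sum>k<N. c k * cis (real (lam k) * t)) / (2 * real M)) \<le> E 1 t + E (-1) t + E \<i> t + E (- \<i>) t"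
      using exp_norm_le[of "1 / real M" "\<Sum>k<N. c k * cis (real (lam k) * t)"]
      unfolding E_def by (simp add: mult.commute)
  qed (intro integrable_circle_measure continuous_intros Bochner_Integration.integrable_add int; use M in auto)+
  also have "\<dots> = (LINT t|circle_measure. E 1 t) + (LINT t|circle_measure. E (-1) t)
      + (LINT t|circle_measure. E \<i> t) + (LINT t|circle_measure. E (- \<i>) t)"
    by (simp add: int)
  also have "\<dots> \<le> 8 * pi * exp (\<Sum>k<N. (norm (c k))\<^sup>2)"
    using bound[of 1] bound[of "-1"] bound[of \<i>] bound[of "- \<i>"] by simp
  finally show ?thesis .
qed

section \<open>From exponential moments to \<open>p\<close>-th moments\<close>

lemma powr_le_exp:
  fixes x p q :: real
  assumes "x \<ge> 0" "p > 0" "q > 0"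
  shows "x powr p \<le> (q * p) powr p * exp (x / q)"
proof -
  \<comment> \<open>The whole estimate is \<open>y \<le> exp y\<close> at
    \<open>y = x / (q * p)\<close>, raised to the power \<open>p\<close>.\<close>
  have "x / (q * p) \<le> exp (x / (q * p))"
    using exp_ge_add_one_self[of "x / (q * p)"] by linarith
  then have "(x / (q * p)) powr p \<le> exp (x / (q * p)) powr p"
    using assms by (intro powr_mono2) auto
  also have "\<dots> = exp (x / q)" using assms by (simp add: powr_def)
  finally have "(q * p) powr p * (x / (q * p)) powr p \<le> (q * p) powr p * exp (x / q)"
    by (intro mult_left_mono) auto
  then show ?thesis using assms by (simp add: powr_mult[symmetric] )
qed

lemma continuous_on_norm_powr:
  fixes g :: "'a::topological_space \<Rightarrow> 'b::real_normed_vector"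
  assumes "continuous_on S g" "p > 0"
  shows "continuous_on S (\<lambda>t. norm (g t) powr p)"
  using assms by (intro continuous_on_powr' continuous_intros) auto

text \<open>\<open>powr_le_exp\<close> with \<open>q = 2 * real M\<close> matches the exponential
  moment already bounded. The bound depends on \<open>p\<close> and \<open>M\<close> only, so it
  survives the limit in \<open>N\<close>.\<close>

lemma integral_norm_powr_partial_le:
  fixes lam :: "nat \<Rightarrow> nat" and c :: "nat \<Rightarrow> complex"
  assumes lam: "\<And>k. lam k > 0" "lacunary A (\<lambda>k. real (lam k))" and M: "M > 0" "2 \<le> A ^ M"
    and p: "p > 0" and c: "(\<Sum>k<N. (norm (c k))\<^sup>2) \<le> 1"
  shows "(LINT t|circle_measure. norm (\<Sum>k<N. c k * cis (real (lam k) * t)) powr p)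
    \<le> (2 * real M * p) powr p * (8 * pi * exp 1)"
proof -
  have "(LINT t|circle_measure. norm (\<Sum>k<N. c k * cis (real (lam k) * t)) powr p)
     \<le> (LINT t|circle_measure. (2 * real M * p) powr p * exp (norm (\<Sum>k<N. c k * cis (real (lam k) * t)) / (2 * real M)))"
    by (intro integral_mono integrable_circle_measure continuous_on_norm_powr continuous_intros powr_le_exp)
       (use M p in auto)
  also have "\<dots> \<le> (2 * real M * p) powr p * (8 * pi * exp (\<Sum>k<N. (norm (c k))\<^sup>2))"
    using integral_exp_norm_lacunary_le[OF lam M, where c = c and N = N]
    by (simp add: mult_left_mono)
  also have "\<dots> \<le> (2 * real M * p) powr p * (8 * pi * exp 1)"
    using c by (intro mult_left_mono) auto
  finally show ?thesis .
qed

text \<open>Models \<open>\<lambda>t. f (cis t * z)\<close> for a fixed \<open>z\<close> in the open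
  disc. There the coefficients are absolutely summable, which makes the convergence uniform in
  \<open>t\<close>.\<close>

locale circle_series =
  fixes lam :: "nat \<Rightarrow> nat" and c :: "nat \<Rightarrow> complex" and g :: "real \<Rightarrow> complex"
  assumes summable_norm: "summable (\<lambda>k. norm (c k))"
    and sums_g: "\<And>t. (\<lambda>k. c k * cis (real (lam k) * t)) sums g t"
begin

lemma norm_partial_le: "norm (\<Sum>k<N. c k * cis (real (lam k) * t)) \<le> (\<Sum>k. norm (c k))"
proof -
  have "norm (\<Sum>k<N. c k * cis (real (lam k) * t)) \<le> (\<Sum>k<N. norm (c k))"
    by (rule order_trans[OF norm_sum]) (simp add: norm_mult)
  also have "\<dots> \<le> (\<Sum>k. norm (c k))" by (rule sum_le_suminf[OF summable_norm]) auto
  finally show ?thesis .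
qed

lemma continuous_g: "continuous_on UNIV g"
proof (rule uniform_limit_theorem)
  have "uniform_limit UNIV (\<lambda>N t. \<Sum>k<N. c k * cis (real (lam k) * t)) (\<lambda>t. \<Sum>k. c k * cis (real (lam k) * t)) sequentially"
    by (rule Weierstrass_m_test[OF _ summable_norm]) (simp add: norm_mult)
  moreover have "(\<lambda>t. \<Sum>k. c k * cis (real (lam k) * t)) = g"
    using sums_g by (simp add: sums_iff fun_eq_iff)
  ultimately show "uniform_limit UNIV (\<lambda>N t. \<Sum>k<N. c k * cis (real (lam k) * t)) g sequentially" by simp
  show "\<forall>\<^sub>F N in sequentially. continuous_on UNIV (\<lambda>t. \<Sum>k<N. c k * cis (real (lam k) * t))"
    by (intro always_eventually allI continuous_intros)
qed auto

lemma integrable_norm_powr: "p > 0 \<Longrightarrow> integrable circle_measure (\<lambda>t. norm (g t) powr p)"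
  by (intro integrable_circle_measure continuous_on_norm_powr continuous_g)

text \<open>The partial sums are dominated by the constant \<open>\<Sum>k. norm (c k)\<close>, whose
  \<open>p\<close>-th power is integrable over the circle.\<close>

lemma integral_norm_powr_partial_tendsto:
  assumes "p > 0"
  shows "(\<lambda>N. LINT t|circle_measure. norm (\<Sum>k<N. c k * cis (real (lam k) * t)) powr p)
    \<longlonglongrightarrow> (LINT t|circle_measure. norm (g t) powr p)"
proof (rule integral_dominated_convergence)
  show "AE t in circle_measure. (\<lambda>N. norm (\<Sum>k<N. c k * cis (real (lam k) * t)) powr p) \<longlonglongrightarrow> norm (g t) powr p"
    using sums_g assms by (intro always_eventually allI tendsto_powr' tendsto_norm tendsto_const) (auto simp: sums_def)
  show "integrable circle_measure (\<lambda>t. (\<Sum>k. norm (c k)) powr p)"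
    by (intro integrable_circle_measure continuous_intros)
  show "AE t in circle_measure. norm (norm (\<Sum>k<N. c k * cis (real (lam k) * t)) powr p) \<le> (\<Sum>k. norm (c k)) powr p" for N
    using norm_partial_le assms by (intro always_eventually allI) (auto intro: powr_mono2)
  show "(\<lambda>t. norm (g t) powr p) \<in> borel_measurable circle_measure"
    using integrable_norm_powr[OF assms] by blast
  show "(\<lambda>t. norm (\<Sum>k<N. c k * cis (real (lam k) * t)) powr p) \<in> borel_measurable circle_measure" for N
    by (intro borel_measurable_integrable integrable_circle_measure continuous_on_norm_powr continuous_intros assms)
qed

end

text \<open>Orthogonality of distinct characters; \<open>inj lam\<close> leaves only the diagonal of
  the double sum.\<close>

lemma integral_norm_square_partial:
  fixes lam :: "nat \<Rightarrow> nat" and c :: "nat \<Rightarrow> complex"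
  assumes "inj lam"
  shows "(LINT t|circle_measure. (norm (\<Sum>k<N. c k * cis (real (lam k) * t)))\<^sup>2) = 2 * pi * (\<Sum>k<N. (norm (c k))\<^sup>2)"
proof -
  have sq: "complex_of_real ((norm (\<Sum>k<N. c k * cis (real (lam k) * t)))\<^sup>2)
     = (\<Sum>j<N. \<Sum>k<N. (c j * cnj (c k)) * cis (of_int (int (lam j) - int (lam k)) * t))" for t
  proof -
    have "cis (of_int (int a - int b) * t) = cis (real a * t) * cnj (cis (real b * t))" for a b
      by (simp add: cis_cnj cis_mult left_diff_distrib)
    then show ?thesis
      unfolding complex_norm_square cnj_sum sum_product by (intro sum.cong refl) simp
  qed
  have "complex_of_real (LINT t|circle_measure. (norm (\<Sum>k<N. c k * cis (real (lam k) * t)))\<^sup>2)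
     = (\<Sum>j<N. \<Sum>k<N. (c j * cnj (c k)) * (LINT t|circle_measure. cis (of_int (int (lam j) - int (lam k)) * t)))"
    unfolding integral_complex_of_real[symmetric] sq
    by (subst Bochner_Integration.integral_sum Bochner_Integration.integral_sum,
        intro integrable_circle_measure continuous_intros)+ simp
  also have "\<dots> = (\<Sum>j<N. \<Sum>k<N. (c j * cnj (c k)) * (if j = k then of_real (2 * pi) else 0))"
  proof (intro sum.cong refl arg_cong2[where f = "(*)"])
    fix j k
    show "(LINT t|circle_measure. cis (of_int (int (lam j) - int (lam k)) * t)) = (if j = k then of_real (2 * pi) else 0)"
      using integral_circle_measure_cis[of "int (lam j) - int (lam k)"] assms
      by (cases "j = k") (auto simp: inj_eq measure_circle_measure scaleR_conv_of_real simp del: of_int_diff)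
  qed
  also have "\<dots> = (\<Sum>j<N. of_real (2 * pi * (norm (c j))\<^sup>2))"
    by (simp add: if_distrib[of "(*) _"] sum.delta cong: if_cong) (simp add: complex_norm_square[symmetric] mult.commute)
  also have "\<dots> = of_real (2 * pi * (\<Sum>k<N. (norm (c k))\<^sup>2))"
    by (simp add: sum_distrib_left)
  finally show ?thesis unfolding of_real_eq_iff .
qed

section \<open>Equivalence of moments on the circle\<close>

context circle_series
begin

lemma summable_norm_square: "summable (\<lambda>k. (norm (c k))\<^sup>2)"
proof (rule summable_comparison_test_ev[OF _ summable_norm])
  have "\<forall>\<^sub>F k in sequentially. norm (c k) < 1"
    using summable_LIMSEQ_zero[OF summable_norm] by (rule order_tendstoD) simp
  then show "\<forall>\<^sub>F k in sequentially. norm ((norm (c k))\<^sup>2) \<le> norm (c k)"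
    by eventually_elim (simp add: power2_eq_square mult_left_le)
qed

lemma integral_norm_square:
  assumes "inj lam"
  shows "(LINT t|circle_measure. norm (g t) powr 2) = 2 * pi * (\<Sum>k. (norm (c k))\<^sup>2)"
proof (rule LIMSEQ_unique)
  show "(\<lambda>N. LINT t|circle_measure. norm (\<Sum>k<N. c k * cis (real (lam k) * t)) powr 2)
    \<longlonglongrightarrow> (LINT t|circle_measure. norm (g t) powr 2)"
    by (rule integral_norm_powr_partial_tendsto) simp
  show "(\<lambda>N. LINT t|circle_measure. norm (\<Sum>k<N. c k * cis (real (lam k) * t)) powr 2)
    \<longlonglongrightarrow> 2 * pi * (\<Sum>k. (norm (c k))\<^sup>2)"
    unfolding powr_numeral[OF norm_ge_zero] integral_norm_square_partial[OF assms]
    by (intro tendsto_mult tendsto_const summable_LIMSEQ summable_norm_square)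
qed

lemma integral_norm_powr_le:
  assumes "\<And>k. lam k > 0" "lacunary A (\<lambda>k. real (lam k))" "M > 0" "2 \<le> A ^ M"
    and "p > 0" and "(\<Sum>k. (norm (c k))\<^sup>2) = 1"
  shows "(LINT t|circle_measure. norm (g t) powr p) \<le> (2 * real M * p) powr p * (8 * pi * exp 1)"
proof (rule LIMSEQ_le_const2[OF integral_norm_powr_partial_tendsto[OF \<open>p > 0\<close>]], intro exI allI impI)
  fix N
  have "(\<Sum>k<N. (norm (c k))\<^sup>2) \<le> 1"
    unfolding assms(6)[symmetric] by (rule sum_le_suminf[OF summable_norm_square]) auto
  then show "(LINT t|circle_measure. norm (\<Sum>k<N. c k * cis (real (lam k) * t)) powr p)
      \<le> (2 * real M * p) powr p * (8 * pi * exp 1)"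
    by (rule integral_norm_powr_partial_le[OF assms(1-5)])
qed

end

text \<open>Three ranges of \<open>x\<close>: the constant absorbs small \<open>x\<close>, the
  fourth power absorbs large \<open>x\<close>, and in between \<open>x powr p\<close> is at least
  \<open>2 powr (- p / 2)\<close> while \<open>x\<^sup>2 < 1 / e\<close>. No comparison of
  \<open>p\<close> with 2 enters.\<close>

lemma square_le_mixed_powers:
  fixes x p e :: real
  assumes "x \<ge> 0" "p > 0" "e > 0"
  shows "x powr 2 \<le> 1 / 2 + e * x powr 4 + (2 powr (p / 2) / e) * x powr p"
proof -
  consider "x\<^sup>2 \<le> 1 / 2" | "x\<^sup>2 \<ge> 1 / e" | "1 / 2 < x\<^sup>2" "x\<^sup>2 < 1 / e" by linarith
  then show ?thesis
  proof cases
    case 1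
    moreover have "0 \<le> e * x powr 4" "0 \<le> (2 powr (p / 2) / e) * x powr p" using assms by auto
    ultimately show ?thesis using assms(1) by simp
  next
    case 2
    then have "1 \<le> e * x\<^sup>2" using assms by (simp add: field_simps)
    then have "x\<^sup>2 * 1 \<le> x\<^sup>2 * (e * x\<^sup>2)" by (intro mult_left_mono) auto
    moreover have "0 \<le> (2 powr (p / 2) / e) * x powr p" using assms by auto
    ultimately show ?thesis using assms(1) by (simp add: power2_eq_square power4_eq_xxxx mult_ac)
  next
    case 3
    then have x: "x > 0" using assms(1) by (cases "x = 0") auto
    have "1 = 2 powr (p / 2) * (1 / 2) powr (p / 2)" by (simp add: powr_divide)
    also have "\<dots> \<le> 2 powr (p / 2) * (x\<^sup>2) powr (p / 2)"
      using 3 assms by (intro mult_left_mono powr_mono2) auto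
    also have "(x\<^sup>2) powr (p / 2) = x powr p"
      using x by (simp add: powr_powr flip: powr_numeral)
    finally have "1 / e \<le> (2 powr (p / 2) / e) * x powr p"
      using assms by (simp add: field_simps)
    moreover have "0 \<le> e * x powr 4" using assms by auto
    ultimately show ?thesis using assms(1) 3 by simp
  qed
qed

text \<open>Averaging the preceding inequality against the bound for the fourth moment keeps the
  \<open>p\<close>-th moment away from zero, for small \<open>p\<close> as well.\<close>

lemma (in circle_series) integral_norm_powr_ge:
  assumes "inj lam" "(\<Sum>k. (norm (c k))\<^sup>2) = 1" "p > 0" "B > 0"
    and B: "(LINT t|circle_measure. norm (g t) powr 4) \<le> B"
  shows "pi / 2 * (pi / (2 * B)) / 2 powr (p / 2) \<le> (LINT t|circle_measure. norm (g t) powr p)"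
proof -
  \<comment> \<open>This choice makes \<open>e * B = pi / 2\<close>. Of the second moment
    \<open>2 * pi\<close>, the constant term takes \<open>pi\<close> and the fourth moment at most
    \<open>pi / 2\<close>, so at least \<open>pi / 2\<close> is left for the \<open>p\<close>-th
    moment.\<close>
  define e where "e = pi / (2 * B)"
  have e: "e > 0" using assms by (simp add: e_def)
  have "2 * pi = (LINT t|circle_measure. norm (g t) powr 2)"
    using integral_norm_square[OF assms(1)] assms(2) by simp
  also have "\<dots> \<le> (LINT t|circle_measure. 1 / 2 + e * norm (g t) powr 4 + (2 powr (p / 2) / e) * norm (g t) powr p)"
    using assms e
    by (intro integral_mono square_le_mixed_powers Bochner_Integration.integrable_add integrable_mult_right integrable_norm_powr)
       (auto intro!: integrable_circle_measure)
  also have "\<dots> = pi + e * (LINT t|circle_measure. norm (g t) powr 4)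
       + (2 powr (p / 2) / e) * (LINT t|circle_measure. norm (g t) powr p)"
    using integrable_circle_measure[of "\<lambda>_. 1 / 2 :: real"] integrable_norm_powr[of 4] integrable_norm_powr[OF \<open>p > 0\<close>]
    by (simp add: measure_circle_measure del: powr_numeral)
  also have "e * (LINT t|circle_measure. norm (g t) powr 4) \<le> e * B"
    using B e by (intro mult_left_mono) auto
  also have "e * B = pi / 2" using assms by (simp add: e_def)
  finally have "2 * pi \<le> pi + pi / 2 + (2 powr (p / 2) / e) * (LINT t|circle_measure. norm (g t) powr p)"
    by simp
  then have "pi / 2 \<le> (2 powr (p / 2) / e) * (LINT t|circle_measure. norm (g t) powr p)" by linarith
  then show ?thesis using e unfolding e_def[symmetric] by (simp add: field_simps)
qed

lemma (in circle_series) scale: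
  "circle_series lam (\<lambda>k. u * c k) (\<lambda>t. u * g t)"
proof
  show "summable (\<lambda>k. norm (u * c k))"
    using summable_norm by (simp add: norm_mult summable_mult)
  show "(\<lambda>k. u * c k * cis (real (lam k) * t)) sums (u * g t)" for t
    using sums_mult[OF sums_g] by (simp add: mult.assoc)
qed

lemma powr_half_square: "x \<ge> 0 \<Longrightarrow> (x\<^sup>2) powr (p / 2) = x powr p" for x :: real
  by (cases "x = 0") (auto simp: powr_powr simp flip: powr_numeral)

text \<open>By homogeneity it suffices to treat series with square sum one. The constant is fixed
  before \<open>lam\<close>, \<open>c\<close> and \<open>g\<close>: it depends on \<open>p\<close>
  and, through \<open>M\<close>, on \<open>A\<close>.\<close>

lemma lacunary_circle_Lp_equivalence:
  fixes p A :: real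
  assumes p: "p > 0" and A: "A > 1"
  obtains C where "C > 0"
    and "\<And>lam c g. circle_series lam c g \<Longrightarrow> (\<And>k. lam k > 0) \<Longrightarrow> lacunary A (\<lambda>k. real (lam k)) \<Longrightarrow>
      inverse C * (\<Sum>k. (norm (c k))\<^sup>2) powr (p / 2) \<le> (LINT t|circle_measure. norm (g t) powr p) \<and>
      (LINT t|circle_measure. norm (g t) powr p) \<le> C * (\<Sum>k. (norm (c k))\<^sup>2) powr (p / 2)"
proof -
  obtain M' where "2 < A ^ M'" using real_arch_pow[OF A] by blast
  define M where "M = Suc M'"
  have M: "M > 0" "2 \<le> A ^ M"
    using \<open>2 < A ^ M'\<close> A power_increasing[of M' M A] unfolding M_def by linarith+
  \<comment> \<open>\<open>B q\<close> bounds the \<open>q\<close>-th moment from above at square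
    sum one; \<open>B 4\<close> is the fourth-moment bound that enters the lower bound
    \<open>L\<close>.\<close>
  define B where "B q = (2 * real M * q) powr q * (8 * pi * exp 1)" for q
  define L where "L = pi / 2 * (pi / (2 * B 4)) / 2 powr (p / 2)"
  have B: "B q > 0" if "q > 0" for q using that M by (simp add: B_def)
  have L: "L > 0" using B[of 4] by (simp add: L_def)
  have unit: "L \<le> (LINT t|circle_measure. norm (g t) powr p) \<and> (LINT t|circle_measure. norm (g t) powr p) \<le> B p"
    if "circle_series lam c g" "\<And>k. lam k > 0" "lacunary A (\<lambda>k. real (lam k))" "(\<Sum>k. (norm (c k))\<^sup>2) = 1"
    for lam c g
  proof -
    interpret circle_series lam c g by fact
    have "inj lam" using lacunary_strict_mono[OF that(2,3)] strict_mono_imp_inj_on by blast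
    then show ?thesis
      unfolding L_def B_def using that M p B
      by (intro conjI integral_norm_powr_ge integral_norm_powr_le) (auto simp: B_def)
  qed
  have main: "L * (\<Sum>k. (norm (c k))\<^sup>2) powr (p / 2) \<le> (LINT t|circle_measure. norm (g t) powr p) \<and>
      (LINT t|circle_measure. norm (g t) powr p) \<le> B p * (\<Sum>k. (norm (c k))\<^sup>2) powr (p / 2)"
    if "circle_series lam c g" "\<And>k. lam k > 0" "lacunary A (\<lambda>k. real (lam k))"
    for lam c g
  proof -
    interpret circle_series lam c g by fact
    define s where "s = sqrt (\<Sum>k. (norm (c k))\<^sup>2)"
    have S: "(\<Sum>k. (norm (c k))\<^sup>2) = s\<^sup>2" and s0: "s \<ge> 0"
      unfolding s_def using suminf_nonneg[OF summable_norm_square] by auto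
    show ?thesis
    \<comment> \<open>Normalisation is impossible for \<open>s = 0\<close>, but then
      \<open>g\<close> vanishes and all sides are zero, by \<open>0 powr x = 0\<close>.\<close>
    proof (cases "s = 0")
      case True
      then have "c k = 0" for k
        using suminf_eq_zero_iff[OF summable_norm_square] S by auto
      then have "(\<lambda>_. 0) sums g t" for t using sums_g[of t] by simp
      then have "g t = 0" for t using sums_unique2[OF _ sums_zero] by blast
      then show ?thesis using True S by simp
    next
      case False
      then have s: "s > 0" using s0 by simp
      have "(\<Sum>k. (norm (of_real (1 / s) * c k))\<^sup>2) = (1 / s)\<^sup>2 * (\<Sum>k. (norm (c k))\<^sup>2)"
        using suminf_mult[OF summable_norm_square, of "(1 / s)\<^sup>2"] s
        by (simp add: norm_divide power_divide)
      also have "\<dots> = 1" using S s by (simp add: power_divide)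
      finally have "L \<le> (LINT t|circle_measure. norm (of_real (1 / s) * g t) powr p) \<and>
         (LINT t|circle_measure. norm (of_real (1 / s) * g t) powr p) \<le> B p"
        using unit[OF scale that(2,3)] by blast
      moreover have "(LINT t|circle_measure. norm (of_real (1 / s) * g t) powr p)
         = (LINT t|circle_measure. norm (g t) powr p) / s powr p"
        using s by (simp add: norm_divide powr_divide)
      moreover have "s powr p > 0" using s by simp
      ultimately show ?thesis
        unfolding S powr_half_square[OF s0] by (simp add: field_simps)
    qed
  qed
  define C where "C = max (B p) (inverse L)"
  have C: "C > 0" "B p \<le> C" using B[OF p] by (auto simp: C_def)
  have "inverse C \<le> inverse (inverse L)" using L by (intro le_imp_inverse_le) (auto simp: C_def)
  then have C': "inverse C \<le> L" by simp
  show ?thesis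
  proof (rule that[OF C(1)])
    fix lam :: "nat \<Rightarrow> nat" and c g
    assume *: "circle_series lam c g" "\<And>k. lam k > 0" "lacunary A (\<lambda>k. real (lam k))"
    let ?S = "(\<Sum>k. (norm (c k))\<^sup>2) powr (p / 2)"
    have "inverse C * ?S \<le> L * ?S" "B p * ?S \<le> C * ?S"
      using C C' by (auto intro!: mult_right_mono)
    then show "inverse C * ?S \<le> (LINT t|circle_measure. norm (g t) powr p) \<and>
      (LINT t|circle_measure. norm (g t) powr p) \<le> C * ?S"
      using main[OF *] by linarith
  qed
qed

section \<open>Rotations and radial functions on the disc\<close>

lemma measurable_Complex: "(\<lambda>(x, y). Complex x y) \<in> borel_measurable (borel \<Otimes>\<^sub>M borel)"
  unfolding borel_measurable_complex_iff by (simp add: case_prod_beta)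

text \<open>Both measures agree on boxes. This form makes Fubini's theorem available in real
  coordinates.\<close>

lemma lborel_complex: "(lborel :: complex measure) = distr (lborel \<Otimes>\<^sub>M lborel) borel (\<lambda>(x, y). Complex x y)"
proof (rule lborel_eqI)
  fix l u :: complex
  assume le: "\<And>b. b \<in> Basis \<Longrightarrow> l \<bullet> b \<le> u \<bullet> b"
  have "(\<lambda>(x, y). Complex x y) -` box l u = {Re l<..<Re u} \<times> {Im l<..<Im u}"
    by (auto simp: in_box_complex_iff)
  moreover have "Re l \<le> Re u" "Im l \<le> Im u"
    using le[of 1] le[of \<i>] by (auto simp: Basis_complex_def)
  moreover have "(\<lambda>(x, y). Complex x y) \<in> (lborel \<Otimes>\<^sub>M lborel) \<rightarrow>\<^sub>M borel"
    using measurable_Complex by (simp cong: measurable_cong_sets)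
  ultimately show "emeasure (distr (lborel \<Otimes>\<^sub>M lborel) borel (\<lambda>(x, y). Complex x y)) (box l u) = (\<Prod>b\<in>Basis. (u - l) \<bullet> b)"
    by (subst emeasure_distr)
       (auto simp: space_pair_measure lborel.emeasure_pair_measure_Times Basis_complex_def ennreal_mult)
qed simp

text \<open>Both orders of integration are provided because each kind of shear needs its own
  variable innermost.\<close>

lemma nn_integral_complex:
  fixes h :: "complex \<Rightarrow> ennreal"
  assumes [measurable]: "h \<in> borel_measurable borel"
  shows "(\<integral>\<^sup>+z. h z \<partial>lborel) = (\<integral>\<^sup>+y. \<integral>\<^sup>+x. h (Complex x y) \<partial>lborel \<partial>lborel)"
    and "(\<integral>\<^sup>+z. h z \<partial>lborel) = (\<integral>\<^sup>+x. \<integral>\<^sup>+y. h (Complex x y) \<partial>lborel \<partial>lborel)"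
proof -
  have [measurable]: "(\<lambda>(x, y). Complex x y) \<in> (lborel \<Otimes>\<^sub>M lborel) \<rightarrow>\<^sub>M borel"
    using measurable_Complex by (simp cong: measurable_cong_sets)
  have "(\<integral>\<^sup>+z. h z \<partial>lborel) = (\<integral>\<^sup>+v. h (case v of (x, y) \<Rightarrow> Complex x y) \<partial>(lborel \<Otimes>\<^sub>M lborel))"
    by (subst lborel_complex) (simp add: nn_integral_distr)
  moreover have "(\<lambda>v. h (case v of (x, y) \<Rightarrow> Complex x y)) \<in> borel_measurable (lborel \<Otimes>\<^sub>M lborel)"
    by measurable
  note m = this
  ultimately show "(\<integral>\<^sup>+z. h z \<partial>lborel) = (\<integral>\<^sup>+y. \<integral>\<^sup>+x. h (Complex x y) \<partial>lborel \<partial>lborel)"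
    and "(\<integral>\<^sup>+z. h z \<partial>lborel) = (\<integral>\<^sup>+x. \<integral>\<^sup>+y. h (Complex x y) \<partial>lborel \<partial>lborel)"
    using lborel_pair.nn_integral_snd[OF m] lborel.nn_integral_fst[OF m] by simp_all
qed

text \<open>With one coordinate fixed, a shear is a translation of the other.\<close>

lemma nn_integral_complex_shear:
  fixes h :: "complex \<Rightarrow> ennreal"
  assumes [measurable]: "h \<in> borel_measurable borel"
  shows "(\<integral>\<^sup>+z. h (Complex (Re z + s * Im z) (Im z)) \<partial>lborel) = (\<integral>\<^sup>+z. h z \<partial>lborel)"
    and "(\<integral>\<^sup>+z. h (Complex (Re z) (Im z + s * Re z)) \<partial>lborel) = (\<integral>\<^sup>+z. h z \<partial>lborel)"
proof -
  have [measurable]: "(\<lambda>z. Complex (Re z + s * Im z) (Im z)) \<in> borel_measurable borel"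
    "(\<lambda>z. Complex (Re z) (Im z + s * Re z)) \<in> borel_measurable borel"
    "(\<lambda>x. Complex x y) \<in> borel_measurable borel" "(\<lambda>x. Complex y x) \<in> borel_measurable borel" for y
    by (subst borel_measurable_complex_iff, simp)+
  show "(\<integral>\<^sup>+z. h (Complex (Re z + s * Im z) (Im z)) \<partial>lborel) = (\<integral>\<^sup>+z. h z \<partial>lborel)"
  proof -
    have "(\<integral>\<^sup>+x. h (Complex x y) \<partial>lborel) = (\<integral>\<^sup>+x. h (Complex (x + s * y) y) \<partial>lborel)" for y
      using nn_integral_real_affine[of "\<lambda>x. h (Complex x y)" 1 "s * y"] by (simp add: add.commute)
    then show ?thesis by (simp add: nn_integral_complex(1))
  qed
  show "(\<integral>\<^sup>+z. h (Complex (Re z) (Im z + s * Re z)) \<partial>lborel) = (\<integral>\<^sup>+z. h z \<partial>lborel)"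
  proof -
    have "(\<integral>\<^sup>+y. h (Complex x y) \<partial>lborel) = (\<integral>\<^sup>+y. h (Complex x (y + s * x)) \<partial>lborel)" for x
      using nn_integral_real_affine[of "\<lambda>y. h (Complex x y)" 1 "s * x"] by (simp add: add.commute)
    then show ?thesis by (simp add: nn_integral_complex(2))
  qed
qed

text \<open>A rotation by an angle other than \<open>\<pi>\<close> is a product of three shears, and the rotation by
  \<open>\<pi>\<close> is the square of the one by \<open>\<pi>/2\<close>.\<close>

lemma nn_integral_complex_rotate:
  fixes h :: "complex \<Rightarrow> ennreal"
  assumes h: "h \<in> borel_measurable borel" and u: "norm u = 1"
  shows "(\<integral>\<^sup>+z. h (u * z) \<partial>lborel) = (\<integral>\<^sup>+z. h z \<partial>lborel)"
proof -
  have rot: "(\<integral>\<^sup>+z. h (u * z) \<partial>lborel) = (\<integral>\<^sup>+z. h z \<partial>lborel)"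
    if "norm u = 1" "u \<noteq> -1" and [measurable]: "h \<in> borel_measurable borel" for u and h :: "complex \<Rightarrow> ennreal"
  proof -
    define a b where "a = Re u" and "b = Im u"
    have ab: "a\<^sup>2 + b\<^sup>2 = 1" using that(1) by (simp add: a_def b_def cmod_def)
    have "1 + a \<noteq> 0"
    proof
      assume "1 + a = 0"
      then have "a = -1" by simp
      then have "u = -1" using ab by (simp add: a_def b_def complex_eq_iff)
      then show False using that by simp
    qed
    \<comment> \<open>For \<open>u = cis \<theta>\<close> this is
      \<open>- tan (\<theta> / 2)\<close>: the rotation is a horizontal shear by \<open>s\<close>, a
      vertical one by \<open>b = sin \<theta>\<close>, and the horizontal one again.\<close>
    define s where "s = - b / (1 + a)"
    have s1: "s * (1 + a) = - b" using \<open>1 + a \<noteq> 0\<close> by (simp add: s_def)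
    have s2: "1 + b * s = a"
    proof -
      have "b\<^sup>2 = (1 - a) * (1 + a)" using ab by (simp add: power2_eq_square algebra_simps)
      then have "b * s = - (1 - a)" using \<open>1 + a \<noteq> 0\<close> by (simp add: s_def power2_eq_square)
      then show ?thesis by simp
    qed
    define X where "X z = Complex (Re z + s * Im z) (Im z)" for z
    define Y where "Y z = Complex (Re z) (Im z + b * Re z)" for z
    have [measurable]: "X \<in> borel_measurable borel" "Y \<in> borel_measurable borel"
      unfolding X_def Y_def by (subst borel_measurable_complex_iff, simp)+
    have "X (Y (X z)) = u * z" for z
    proof -
      have im: "Im z + b * (Re z + s * Im z) = b * Re z + a * Im z"
        unfolding s2[symmetric] by (simp add: algebra_simps)
      have re: "(Re z + s * Im z) + s * (b * Re z + a * Im z) = a * Re z - b * Im z"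
      proof -
        have "(Re z + s * Im z) + s * (b * Re z + a * Im z) = (1 + b * s) * Re z + (s * (1 + a)) * Im z"
          by (simp add: algebra_simps)
        then show ?thesis unfolding s1 s2 by simp
      qed
      have "X (Y (X z)) = Complex (a * Re z - b * Im z) (b * Re z + a * Im z)"
        unfolding X_def Y_def complex.sel im re ..
      then show ?thesis by (simp add: complex_eq_iff a_def b_def)
    qed
    then have "(\<integral>\<^sup>+z. h (u * z) \<partial>lborel) = (\<integral>\<^sup>+z. h (X (Y (X z))) \<partial>lborel)" by simp
    also have "\<dots> = (\<integral>\<^sup>+z. h (X (Y z)) \<partial>lborel)"
      using nn_integral_complex_shear(1)[of "\<lambda>z. h (X (Y z))" s] unfolding X_def[symmetric] by measurable
    also have "\<dots> = (\<integral>\<^sup>+z. h (X z) \<partial>lborel)"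
      using nn_integral_complex_shear(2)[of "\<lambda>z. h (X z)" b] unfolding Y_def[symmetric] by measurable
    also have "\<dots> = (\<integral>\<^sup>+z. h z \<partial>lborel)"
      using nn_integral_complex_shear(1)[of h s] unfolding X_def[symmetric] by measurable
    finally show ?thesis .
  qed
  show ?thesis
  proof (cases "u = -1")
    case True
    have "(\<integral>\<^sup>+z. h (u * z) \<partial>lborel) = (\<integral>\<^sup>+z. h (\<i> * (\<i> * z)) \<partial>lborel)" by (simp add: True)
    also have "\<dots> = (\<integral>\<^sup>+z. h (\<i> * z) \<partial>lborel)"
      by (rule rot) (use h in \<open>auto simp: complex_eq_iff\<close>)
    also have "\<dots> = (\<integral>\<^sup>+z. h z \<partial>lborel)"
      by (rule rot) (use h in \<open>auto simp: complex_eq_iff\<close>)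
    finally show ?thesis .
  qed (use rot u h in auto)
qed

text \<open>For \<open>0 \<le> x < 1\<close> the part of the disc where
  \<open>(norm z)\<^sup>2\<close> exceeds \<open>x\<close> has area \<open>pi * (1 - x)\<close>,
  which is linear in \<open>x\<close>. Agreement on all upper rays, with finite values there,
  determines the measure.\<close>

lemma distr_norm_square_disc:
  "distr (density lborel (indicator (ball 0 1))) borel (\<lambda>z::complex. (norm z)\<^sup>2)
    = density lborel (\<lambda>t. ennreal pi * indicator {0..<1} t)" (is "?M = ?N")
proof -
  have vol: "emeasure lborel (ball (0::complex) 1) = ennreal pi"
    by (simp add: emeasure_ball unit_ball_vol_2)
  have M: "emeasure ?M {x<..} = emeasure lborel (ball 0 1 \<inter> {z::complex. x < (norm z)\<^sup>2})" for x
  proof -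
    have "emeasure ?M {x<..} = emeasure (density lborel (indicator (ball 0 1))) {z::complex. x < (norm z)\<^sup>2}"
      by (subst emeasure_distr) (auto simp: vimage_def)
    also have "\<dots> = (\<integral>\<^sup>+z. indicator (ball 0 1 \<inter> {z::complex. x < (norm z)\<^sup>2}) z \<partial>lborel)"
      by (subst emeasure_density) (auto simp: indicator_def simp del: nn_integral_indicator intro!: borel_measurable_indicator nn_integral_cong)
    also have "\<dots> = emeasure lborel (ball 0 1 \<inter> {z::complex. x < (norm z)\<^sup>2})"
      by (rule nn_integral_indicator) auto
    finally show ?thesis .
  qed
  have N: "emeasure ?N {x<..} = ennreal pi * emeasure lborel ({0..<1} \<inter> {x<..})" for x
    by (subst emeasure_density)
       (auto simp: nn_integral_cmult mult.assoc indicator_inter_arith[symmetric])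
  have eq: "emeasure ?M {x<..} = emeasure ?N {x<..}" for x
  proof -
    consider "x < 0" | "0 \<le> x" "x < 1" | "1 \<le> x" by linarith
    then show ?thesis
    proof cases
      case 1
      then have "ball 0 1 \<inter> {z::complex. x < (norm z)\<^sup>2} = ball 0 1" "{0..<1} \<inter> {x<..} = {0..<1}"
        by (auto intro: less_le_trans)
      then show ?thesis unfolding M N using vol by simp
    next
      case 2
      have "ball 0 1 \<inter> {z::complex. x < (norm z)\<^sup>2} = ball 0 1 - cball 0 (sqrt x)"
      proof -
        have "x < (norm z)\<^sup>2 \<longleftrightarrow> sqrt x < norm z" for z :: complex
          using real_sqrt_less_iff[of x "(norm z)\<^sup>2"] by simp
        then show ?thesis
          by (simp only: set_eq_iff Int_iff Diff_iff mem_Collect_eq mem_ball_0 mem_cball_0 not_le simp_thms)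
      qed
      moreover have "emeasure lborel (ball (0::complex) 1 - cball 0 (sqrt x)) = ennreal pi - ennreal (pi * x)"
      proof (subst emeasure_Diff)
        have "emeasure lborel (cball (0::complex) (sqrt x)) = ennreal (pi * x)"
          using 2 by (simp add: emeasure_cball unit_ball_vol_2)
        then show "emeasure lborel (ball (0::complex) 1) - emeasure lborel (cball (0::complex) (sqrt x)) = ennreal pi - ennreal (pi * x)"
          "emeasure lborel (cball (0::complex) (sqrt x)) \<noteq> \<infinity>"
          using vol by auto
        show "cball 0 (sqrt x) \<subseteq> ball (0::complex) 1"
        proof
          fix z :: complex assume "z \<in> cball 0 (sqrt x)"
          moreover have "sqrt x < 1" using 2 by simp
          ultimately show "z \<in> ball 0 1"
            unfolding mem_cball_0 mem_ball_0 by (rule le_less_trans)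
        qed
      qed auto
      moreover have "{0..<1} \<inter> {x<..} = {x<..<1}" using 2 by auto
      ultimately show ?thesis
        unfolding M N using 2 by (simp add: ennreal_minus ennreal_mult[symmetric] right_diff_distrib)
    next
      case 3
      have "ball 0 1 \<inter> {z::complex. x < (norm z)\<^sup>2} = {}"
      proof -
        have "\<not> x < (norm z)\<^sup>2" if "norm z < 1" for z :: complex
          using abs_square_less_1[of "norm z"] that 3 by simp
        then show ?thesis by auto
      qed
      moreover have "{0..<1} \<inter> {x<..} = {}" using 3 by auto
      ultimately show ?thesis unfolding M N by simp
    qed
  qed
  show ?thesis
  proof (rule measure_eqI_lessThan)
    show "emeasure ?M {x<..} < \<infinity>" for x
      unfolding M by (rule le_less_trans[OF emeasure_mono[of _ "ball 0 1"]]) (auto simp: vol)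
  qed (use eq in auto)
qed

lemma nn_integral_disc_radial_square:
  fixes h :: "real \<Rightarrow> ennreal"
  assumes [measurable]: "h \<in> borel_measurable borel"
  shows "(\<integral>\<^sup>+z\<in>ball (0::complex) 1. h ((norm z)\<^sup>2) \<partial>lborel) = ennreal pi * (\<integral>\<^sup>+t\<in>{0..<1}. h t \<partial>lborel)"
proof -
  have "(\<integral>\<^sup>+z\<in>ball (0::complex) 1. h ((norm z)\<^sup>2) \<partial>lborel)
      = (\<integral>\<^sup>+t. h t \<partial>distr (density lborel (indicator (ball 0 1))) borel (\<lambda>z::complex. (norm z)\<^sup>2))"
    by (subst nn_integral_distr, simp, simp, subst nn_integral_density)
       (auto simp: mult.commute intro!: borel_measurable_indicator)
  also have "\<dots> = ennreal pi * (\<integral>\<^sup>+t\<in>{0..<1}. h t \<partial>lborel)"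
    unfolding distr_norm_square_disc by (simp add: nn_integral_density mult.assoc nn_integral_cmult mult.commute[of "h _"])
  finally show ?thesis .
qed

text \<open>In the variable \<open>t = (norm z)\<^sup>2\<close> the integrand is
  \<open>G (sqrt t)\<close>. Monotonicity with \<open>t \<le> sqrt t\<close> gives the lower bound;
  with \<open>sqrt t \<le> (1 + t) / 2\<close> it gives the upper one, where the affine substitution
  onto \<open>{1/2..<1}\<close> costs a factor 2.\<close>

lemma nn_integral_disc_radial_mono:
  fixes G :: "real \<Rightarrow> ennreal"
  assumes [measurable]: "G \<in> borel_measurable borel" and mono: "mono_on {0..<1} G"
  shows "ennreal pi * (\<integral>\<^sup>+r\<in>{0..<1}. G r \<partial>lborel) \<le> (\<integral>\<^sup>+z\<in>ball (0::complex) 1. G (norm z) \<partial>lborel)"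
    and "(\<integral>\<^sup>+z\<in>ball (0::complex) 1. G (norm z) \<partial>lborel) \<le> ennreal (2 * pi) * (\<integral>\<^sup>+r\<in>{0..<1}. G r \<partial>lborel)"
proof -
  have eq: "(\<integral>\<^sup>+z\<in>ball (0::complex) 1. G (norm z) \<partial>lborel) = ennreal pi * (\<integral>\<^sup>+t\<in>{0..<1}. G (sqrt t) \<partial>lborel)"
    using nn_integral_disc_radial_square[of "\<lambda>t. G (sqrt t)"] by simp
  have sqrt: "t \<le> sqrt t" "sqrt t \<le> 1 / 2 + 1 / 2 * t" if "0 \<le> t" "t < 1" for t :: real
  proof -
    have "t\<^sup>2 \<le> t" using that by (simp add: power2_eq_square mult_left_le)
    then show "t \<le> sqrt t" by (rule real_le_rsqrt)
    show "sqrt t \<le> 1 / 2 + 1 / 2 * t"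
      using arith_geo_mean_sqrt[of 1 t] that by simp
  qed
  show "ennreal pi * (\<integral>\<^sup>+r\<in>{0..<1}. G r \<partial>lborel) \<le> (\<integral>\<^sup>+z\<in>ball (0::complex) 1. G (norm z) \<partial>lborel)"
    unfolding eq using sqrt(1)
    by (intro mult_left_mono nn_integral_mono) (auto simp: indicator_def intro!: mono_onD[OF mono] )
  have "(\<integral>\<^sup>+t\<in>{0..<1}. G (sqrt t) \<partial>lborel) \<le> (\<integral>\<^sup>+t. G (1 / 2 + 1 / 2 * t) * indicator {1/2..<1} (1 / 2 + 1 / 2 * t) \<partial>lborel)"
    using sqrt(2) by (intro nn_integral_mono) (auto simp: indicator_def intro!: mono_onD[OF mono])
  \<comment> \<open>The factor 2 times \<open>1 / 2\<close> is inserted to match the Jacobian in the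
    affine substitution rule.\<close>
  also have "\<dots> = 2 * (ennreal (1 / 2) * (\<integral>\<^sup>+t. G (1 / 2 + 1 / 2 * t) * indicator {1/2..<1} (1 / 2 + 1 / 2 * t) \<partial>lborel))"
    unfolding mult.assoc[symmetric] ennreal_numeral[symmetric] by (subst ennreal_mult[symmetric]) (auto simp del: ennreal_numeral)
  also have "\<dots> = 2 * (\<integral>\<^sup>+t\<in>{1/2..<1}. G t \<partial>lborel)"
    by (subst nn_integral_real_affine[where c = "1 / 2" and t = "1 / 2"]) auto
  also have "\<dots> \<le> 2 * (\<integral>\<^sup>+t\<in>{0..<1}. G t \<partial>lborel)"
    by (intro mult_left_mono nn_integral_mono) (auto simp: indicator_def)
  finally have "(\<integral>\<^sup>+t\<in>{0..<1}. G (sqrt t) \<partial>lborel) \<le> 2 * (\<integral>\<^sup>+t\<in>{0..<1}. G t \<partial>lborel)" .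
  from mult_left_mono[OF this, of "ennreal pi"]
  show "(\<integral>\<^sup>+z\<in>ball (0::complex) 1. G (norm z) \<partial>lborel) \<le> ennreal (2 * pi) * (\<integral>\<^sup>+r\<in>{0..<1}. G r \<partial>lborel)"
    unfolding eq by (simp add: ennreal_mult mult_ac)
qed

section \<open>Lacunary series on the disc\<close>

lemma measurable_circle_measure_ident [measurable]: "(\<lambda>t. t) \<in> circle_measure \<rightarrow>\<^sub>M borel"
  unfolding circle_measure_def by (rule measurable_restrict_space1) simp

text \<open>The disc and Lebesgue measure are invariant under rotation, so averaging over all angles
  and exchanging the integrals stands in for polar coordinates.\<close>

lemma nn_integral_disc_circle_average:
  fixes h :: "complex \<Rightarrow> ennreal"
  assumes [measurable]: "h \<in> borel_measurable borel"
  shows "ennreal (2 * pi) * (\<integral>\<^sup>+z\<in>ball 0 1. h z \<partial>lborel)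
    = (\<integral>\<^sup>+z\<in>ball 0 1. (\<integral>\<^sup>+t. h (cis t * z) \<partial>circle_measure) \<partial>lborel)"
proof -
  interpret C: finite_measure circle_measure by (rule finite_measure_circle_measure)
  interpret P: pair_sigma_finite circle_measure "lborel :: complex measure" ..
  \<comment> \<open>Cutting \<open>h\<close> off outside the disc produces integrals over the whole
    plane, for which rotation invariance was proved.\<close>
  define F where "F z = h z * indicator (ball 0 1) z" for z
  have [measurable]: "F \<in> borel_measurable borel" unfolding F_def
    by (intro borel_measurable_times_ennreal borel_measurable_indicator assms) auto
  have [measurable]: "cis \<in> borel_measurable borel"
    by (intro borel_measurable_continuous_onI continuous_intros)
  have "ennreal (2 * pi) * (\<integral>\<^sup>+z\<in>ball 0 1. h z \<partial>lborel) = (\<integral>\<^sup>+t. (\<integral>\<^sup>+z. F z \<partial>lborel) \<partial>circle_measure)"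
    by (simp add: F_def C.emeasure_eq_measure measure_circle_measure) (simp add: mult.commute)
  also have "\<dots> = (\<integral>\<^sup>+t. (\<integral>\<^sup>+z. F (cis t * z) \<partial>lborel) \<partial>circle_measure)"
    by (subst nn_integral_complex_rotate) auto
  also have "\<dots> = (\<integral>\<^sup>+z. (\<integral>\<^sup>+t. F (cis t * z) \<partial>circle_measure) \<partial>lborel)"
    by (rule P.Fubini'[symmetric]) measurable
  also have "\<dots> = (\<integral>\<^sup>+z\<in>ball 0 1. (\<integral>\<^sup>+t. h (cis t * z) \<partial>circle_measure) \<partial>lborel)"
    by (intro nn_integral_cong) (auto simp: F_def norm_mult indicator_def)
  finally show ?thesis .
qed

context
  fixes lam :: "nat \<Rightarrow> nat" and a :: "nat \<Rightarrow> complex" and f :: "complex \<Rightarrow> complex" and A :: real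
  assumes lam: "\<And>k. lam k > 0" "lacunary A (\<lambda>k. real (lam k))"
    and f: "holomorphic_gap_series lam a f"
begin

text \<open>Convergence at a slightly larger radius \<open>r\<close> bounds the terms there, and
  this leaves a geometric series at \<open>z\<close>.\<close>

lemma summable_norm_gap_series:
  assumes "norm z < 1"
  shows "summable (\<lambda>k. norm (a (lam k) * z ^ lam k))"
proof -
  define r where "r = (norm z + 1) / 2"
  have r: "norm z < r" "r < 1" "r > 0" using assms norm_ge_zero[of z] by (simp_all add: r_def del: norm_ge_zero)
  have "summable (\<lambda>k. a (lam k) * of_real r ^ lam k)"
    using f r by (auto simp: holomorphic_gap_series_def sums_iff)
  then have "Bseq (\<lambda>k. a (lam k) * of_real r ^ lam k)"
    by (rule summable_LIMSEQ_zero[THEN convergentI, THEN convergent_imp_Bseq])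
  then obtain B where B: "\<And>k. norm (a (lam k) * of_real r ^ lam k) \<le> B" "B > 0"
    by (auto simp: Bseq_def)
  define q where "q = norm z / r"
  have q: "0 \<le> q" "q < 1" using r by (auto simp: q_def)
  show ?thesis
  proof (rule summable_comparison_test')
    show "summable (\<lambda>k. B * q ^ k)" using q by (intro summable_mult summable_geometric) auto
    fix k
    have "norm (norm (a (lam k) * z ^ lam k)) = norm (a (lam k) * of_real r ^ lam k) * q ^ lam k"
      using r by (simp add: q_def norm_mult norm_power power_divide)
    \<comment> \<open>Strict monotonicity gives \<open>k \<le> lam k\<close>, hence
      \<open>q ^ lam k \<le> q ^ k\<close>.\<close>
    also have "\<dots> \<le> B * q ^ k"
      using B q strict_mono_imp_increasing[OF lacunary_strict_mono[OF lam]]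
      by (intro mult_mono power_decreasing) auto
    finally show "norm (norm (a (lam k) * z ^ lam k)) \<le> B * q ^ k" .
  qed
qed

text \<open>De Moivre's formula. The argument of \<open>z\<close> is absorbed into the coefficients,
  whose norms depend on \<open>norm z\<close> only.\<close>

lemma circle_series_gap_series:
  assumes "norm z < 1"
  shows "circle_series lam (\<lambda>k. a (lam k) * z ^ lam k) (\<lambda>t. f (cis t * z))"
proof
  show "(\<lambda>k. a (lam k) * z ^ lam k * cis (real (lam k) * t)) sums f (cis t * z)" for t
  proof -
    have "(\<lambda>k. a (lam k) * (cis t * z) ^ lam k) sums f (cis t * z)"
      using f assms by (auto simp: holomorphic_gap_series_def norm_mult)
    moreover have "a (lam k) * (cis t * z) ^ lam k = a (lam k) * z ^ lam k * cis (real (lam k) * t)" for k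
      by (simp only: power_mult_distrib Complex.DeMoivre mult_ac)
    ultimately show ?thesis by simp
  qed
qed (rule summable_norm_gap_series[OF assms])

lemma norm_gap_term_square:
  "(norm (a (lam k) * z ^ lam k))\<^sup>2 = (norm (a (lam k)))\<^sup>2 * norm z ^ (2 * lam k)"
  by (simp add: norm_mult norm_power power_mult_distrib power_mult[symmetric] mult.commute)

lemma summable_square_function:
  assumes "0 \<le> r" "r < 1"
  shows "summable (\<lambda>k. (norm (a (lam k)))\<^sup>2 * r ^ (2 * lam k))"
  using circle_series.summable_norm_square[OF circle_series_gap_series, of "of_real r"] assms
  by (simp add: norm_gap_term_square)

lemma mono_on_square_function:
  assumes "p > 0"
  shows "mono_on {0..<1} (\<lambda>r. ennreal ((\<Sum>k. (norm (a (lam k)))\<^sup>2 * r ^ (2 * lam k)) powr (p / 2)))"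
  using assms
  by (intro mono_onI ennreal_leI powr_mono2 suminf_le summable_square_function mult_left_mono power_mono suminf_nonneg) auto

text \<open>Nothing is known of \<open>f\<close> outside the disc. The cut-off function is Borel on
  the whole plane, as the averaging over rotations requires.\<close>

lemma disc_integral_lborel:
  "disc_integral p f = (\<integral>\<^sup>+z\<in>ball 0 1. ennreal (norm (f z * indicator (ball 0 1) z) powr p) \<partial>lborel)"
  unfolding disc_integral_def nn_integral_completion by (intro nn_integral_cong) (auto simp: indicator_def)

lemma borel_measurable_gap_series:
  "(\<lambda>z. f z * indicator (ball 0 1) z) \<in> borel_measurable borel"
proof -
  have "continuous_on (ball 0 1) f"
    using f holomorphic_on_imp_continuous_on by (auto simp: holomorphic_gap_series_def)
  then have "(\<lambda>z. indicator (ball 0 1) z *\<^sub>R f z) \<in> borel_measurable borel"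
    by (intro borel_measurable_continuous_on_indicator) auto
  also have "(\<lambda>z. indicator (ball 0 1) z *\<^sub>R f z) = (\<lambda>z. f z * indicator (ball 0 1) z)"
    by (auto simp: indicator_def)
  finally show ?thesis .
qed

text \<open>Holomorphy supplies the measurability, so only finiteness of the integral
  remains.\<close>

lemma Lp_integrable_on_disc_iff:
  "Lp_integrable_on p (ball 0 1) f \<longleftrightarrow> disc_integral p f < \<infinity>"
proof -
  have m: "(\<lambda>z. f z * indicator (ball 0 1) z) \<in> borel_measurable lebesgue"
    by (rule measurable_completion) (simp add: borel_measurable_gap_series)
  \<comment> \<open>Outside the disc this rests on \<open>0 powr p = 0\<close>.\<close>
  have eq: "(\<lambda>z. indicator (ball 0 1) z *\<^sub>R (norm (f z) powr p))
     = (\<lambda>z. norm (f z * indicator (ball 0 1) z) powr p)"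
    by (auto simp: indicator_def)
  have "set_borel_measurable lebesgue (ball 0 1) f"
    using m unfolding set_borel_measurable_def
    by (rule measurable_cong[THEN iffD1, rotated]) (auto simp: indicator_def)
  moreover have "(\<lambda>z. norm (f z * indicator (ball 0 1) z) powr p) \<in> borel_measurable lebesgue"
    by (rule measurable_compose[OF m]) simp
  moreover have "disc_integral p f = (\<integral>\<^sup>+z. ennreal (norm (f z * indicator (ball 0 1) z) powr p) \<partial>lebesgue)"
    unfolding disc_integral_def by (intro nn_integral_cong) (auto simp: indicator_def)
  ultimately show ?thesis
    unfolding Lp_integrable_on_def set_integrable_def eq integrable_iff_bounded by simp
qed

text \<open>The circle estimate is applied at every \<open>z\<close> of the disc and integrated. The
  rotation average carries the factor \<open>2 * pi\<close> and the radial comparison the factors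
  \<open>pi\<close> and \<open>2 * pi\<close>, which accounts for passing from \<open>C\<close> to
  \<open>2 * C\<close>.\<close>

lemma disc_integral_equivalence:
  assumes p: "p > 0" and C: "C > 0"
    and circle: "\<And>c g. circle_series lam c g \<Longrightarrow>
      inverse C * (\<Sum>k. (norm (c k))\<^sup>2) powr (p / 2) \<le> (LINT t|circle_measure. norm (g t) powr p) \<and>
      (LINT t|circle_measure. norm (g t) powr p) \<le> C * (\<Sum>k. (norm (c k))\<^sup>2) powr (p / 2)"
  shows "ennreal (inverse (2 * C)) * square_function_integral p lam a \<le> disc_integral p f"
    and "disc_integral p f \<le> ennreal (2 * C) * square_function_integral p lam a"
proof -
  define G where "G r = ennreal ((\<Sum>k. (norm (a (lam k)))\<^sup>2 * r ^ (2 * lam k)) powr (p / 2))" for r :: real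
  define I where "I = (\<integral>\<^sup>+z\<in>ball (0::complex) 1. G (norm z) \<partial>lborel)"
  define Q where "Q = (\<integral>\<^sup>+r\<in>{0..<1}. G r \<partial>lborel)"
  have [measurable]: "G \<in> borel_measurable borel" unfolding G_def by measurable
  have mono: "mono_on {0..<1} G" unfolding G_def by (rule mono_on_square_function[OF p])
  have Q: "square_function_integral p lam a = Q"
    by (simp add: square_function_integral_def nn_integral_completion Q_def G_def)
  have I: "ennreal pi * Q \<le> I" "I \<le> ennreal (2 * pi) * Q"
    unfolding I_def Q_def by (rule nn_integral_disc_radial_mono[OF _ mono]; measurable)+
  have D: "ennreal (2 * pi) * disc_integral p f = (\<integral>\<^sup>+z\<in>ball 0 1.
      (\<integral>\<^sup>+t. ennreal (norm (f (cis t * z) * indicator (ball 0 1) (cis t * z)) powr p) \<partial>circle_measure) \<partial>lborel)"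
    unfolding disc_integral_lborel
    by (intro nn_integral_disc_circle_average measurable_compose[OF borel_measurable_gap_series, of "\<lambda>w. ennreal (norm w powr p)"])
       simp
  have pt: "ennreal (inverse C) * G (norm z)
        \<le> (\<integral>\<^sup>+t. ennreal (norm (f (cis t * z) * indicator (ball 0 1) (cis t * z)) powr p) \<partial>circle_measure) \<and>
      (\<integral>\<^sup>+t. ennreal (norm (f (cis t * z) * indicator (ball 0 1) (cis t * z)) powr p) \<partial>circle_measure)
        \<le> ennreal C * G (norm z)" if z: "norm z < 1" for z
  proof -
    interpret circle_series lam "\<lambda>k. a (lam k) * z ^ lam k" "\<lambda>t. f (cis t * z)"
      by (rule circle_series_gap_series[OF z])
    have "(\<integral>\<^sup>+t. ennreal (norm (f (cis t * z) * indicator (ball 0 1) (cis t * z)) powr p) \<partial>circle_measure)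
       = (\<integral>\<^sup>+t. ennreal (norm (f (cis t * z)) powr p) \<partial>circle_measure)"
      using z by (simp add: norm_mult)
    also have "\<dots> = ennreal (LINT t|circle_measure. norm (f (cis t * z)) powr p)"
      by (intro nn_integral_eq_integral integrable_norm_powr p) auto
    finally show ?thesis
      using circle[OF circle_series_axioms] C
      by (auto simp: G_def norm_gap_term_square ennreal_mult[symmetric] intro!: ennreal_leI)
  qed
  have lower: "ennreal (inverse C) * I \<le> ennreal (2 * pi) * disc_integral p f"
    unfolding D I_def using pt
    by (subst nn_integral_cmult[symmetric]) (auto intro!: nn_integral_mono simp: indicator_def)
  have upper: "ennreal (2 * pi) * disc_integral p f \<le> ennreal C * I"
    unfolding D I_def using pt
    by (subst nn_integral_cmult[symmetric]) (auto intro!: nn_integral_mono simp: indicator_def)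
  \<comment> \<open>Cancelling the finite positive factor \<open>2 * pi\<close> is valid in
    \<open>ennreal\<close> even when a side is infinite.\<close>
  have cancel: "x \<le> y" if "ennreal (2 * pi) * x \<le> ennreal (2 * pi) * y" for x y
  proof -
    have "ennreal (1 / (2 * pi)) * (ennreal (2 * pi) * x) \<le> ennreal (1 / (2 * pi)) * (ennreal (2 * pi) * y)"
      by (rule mult_left_mono[OF that]) simp
    then show ?thesis unfolding mult.assoc[symmetric] by (simp add: ennreal_mult[symmetric])
  qed
  show "ennreal (inverse (2 * C)) * square_function_integral p lam a \<le> disc_integral p f"
  proof (rule cancel)
    have "ennreal (2 * pi) * (ennreal (inverse (2 * C)) * Q) = ennreal (inverse C) * (ennreal pi * Q)"
      unfolding mult.assoc[symmetric] using C by (simp add: ennreal_mult[symmetric] mult.commute)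
    also have "\<dots> \<le> ennreal (inverse C) * I" by (rule mult_left_mono[OF I(1)]) simp
    also note lower
    finally show "ennreal (2 * pi) * (ennreal (inverse (2 * C)) * square_function_integral p lam a)
        \<le> ennreal (2 * pi) * disc_integral p f" unfolding Q .
  qed
  show "disc_integral p f \<le> ennreal (2 * C) * square_function_integral p lam a"
  proof (rule cancel)
    note upper
    also have "ennreal C * I \<le> ennreal C * (ennreal (2 * pi) * Q)" by (rule mult_left_mono[OF I(2)]) simp
    \<comment> \<open>The upper bound holds with \<open>C\<close> itself; it is enlarged to share
      the constant \<open>2 * C\<close> with the lower bound.\<close>
    also have "\<dots> \<le> ennreal (2 * pi) * (ennreal (2 * C) * Q)"
      unfolding mult.assoc[symmetric] using C
      by (simp add: ennreal_mult[symmetric]) (auto intro!: mult_right_mono ennreal_leI)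
    finally show "ennreal (2 * pi) * disc_integral p f
        \<le> ennreal (2 * pi) * (ennreal (2 * C) * square_function_integral p lam a)" unfolding Q .
  qed
qed

end

theorem theorem1p4:
  fixes p A :: real
  assumes "p > 0" and "A > 1"
  shows "(\<exists>C::real. C > 0 \<and>
      (\<forall>(lam :: nat \<Rightarrow> nat) (a :: nat \<Rightarrow> complex) (f :: complex \<Rightarrow> complex).
        (\<forall>k. lam k > 0) \<longrightarrow> lacunary A (\<lambda>k. real (lam k)) \<longrightarrow> holomorphic_gap_series lam a f \<longrightarrow>
          ennreal (inverse C) * square_function_integral p lam a \<le> disc_integral p f \<and>
          disc_integral p f \<le> ennreal C * square_function_integral p lam a))
    \<and> (\<forall>(lam :: nat \<Rightarrow> nat) (a :: nat \<Rightarrow> complex) (f :: complex \<Rightarrow> complex).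
        (\<forall>k. lam k > 0) \<longrightarrow> lacunary A (\<lambda>k. real (lam k)) \<longrightarrow> holomorphic_gap_series lam a f \<longrightarrow>
          (Lp_integrable_on p (ball 0 1) f \<longleftrightarrow> square_function_integral p lam a < \<infinity>))"
proof -
  obtain C where C: "C > 0"
    and circle: "\<And>lam c g. circle_series lam c g \<Longrightarrow> (\<And>k. lam k > 0) \<Longrightarrow> lacunary A (\<lambda>k. real (lam k)) \<Longrightarrow>
      inverse C * (\<Sum>k. (norm (c k))\<^sup>2) powr (p / 2) \<le> (LINT t|circle_measure. norm (g t) powr p) \<and>
      (LINT t|circle_measure. norm (g t) powr p) \<le> C * (\<Sum>k. (norm (c k))\<^sup>2) powr (p / 2)"
    using lacunary_circle_Lp_equivalence[OF assms] by blast
  have bounds: "ennreal (inverse (2 * C)) * square_function_integral p lam a \<le> disc_integral p f"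
      "disc_integral p f \<le> ennreal (2 * C) * square_function_integral p lam a"
    if *: "\<forall>k. lam k > 0" "lacunary A (\<lambda>k. real (lam k))" "holomorphic_gap_series lam a f" for lam a f
  proof -
    have pos: "lam k > 0" for k using * by blast
    show "ennreal (inverse (2 * C)) * square_function_integral p lam a \<le> disc_integral p f"
      "disc_integral p f \<le> ennreal (2 * C) * square_function_integral p lam a"
      by (rule disc_integral_equivalence[OF pos *(2,3) assms(1) C circle[OF _ pos *(2)]]; assumption)+
  qed
  \<comment> \<open>The constants in both bounds are finite and positive, so finiteness passes in
    each direction.\<close>
  have "Lp_integrable_on p (ball 0 1) f \<longleftrightarrow> square_function_integral p lam a < \<infinity>"
    if *: "\<forall>k. lam k > 0" "lacunary A (\<lambda>k. real (lam k))" "holomorphic_gap_series lam a f" for lam a f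
  proof -
    have "Lp_integrable_on p (ball 0 1) f \<longleftrightarrow> disc_integral p f < \<infinity>"
      using * Lp_integrable_on_disc_iff by blast
    also have "\<dots> \<longleftrightarrow> square_function_integral p lam a < \<infinity>"
    proof
      assume "disc_integral p f < \<infinity>"
      then have "ennreal (inverse (2 * C)) * square_function_integral p lam a < \<infinity>"
        using bounds(1)[OF *] by (rule le_less_trans[rotated])
      then show "square_function_integral p lam a < \<infinity>"
        using C by (auto simp: ennreal_mult_less_top)
    next
      assume "square_function_integral p lam a < \<infinity>"
      then have "ennreal (2 * C) * square_function_integral p lam a < \<infinity>"
        by (simp add: ennreal_mult_less_top)
      then show "disc_integral p f < \<infinity>" using bounds(2)[OF *] by (rule le_less_trans[rotated])
    qed
    finally show ?thesis .
  qed
  then show ?thesis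
    using bounds C by (intro conjI exI[of _ "2 * C"]) auto
qed

end
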